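(* Let $G$ be a group and let $(\rho_1,V)$, $(\rho_2,W)$ be two complex representations of $G$. Suppose that there is a nested sequence of $G$-invariant subspaces of $V$: $$0=V_0\subset V_1\subset V_2\subset\cdots\subset V_r=V\qquad(r\ge 1).$$ For each $i$ let $\mathcal{F}_{V_i}:=\{f:G\to V_i\}$ denote the corresponding subspace of feature maps. Let $\Psi:\mathcal{F}_V\to\mathcal{F}_W$ be a $G$-linear map. Then there exists a nested sequence of $G$-invariant subspaces of $W$: $$0=W_0\subset W_1\subset W_2\subset\cdots\subset W_r=W$$ such that $\Psi(\mathcal{F}_{V_i})\subseteq\mathcal{F}_{W_i}$ for all $i=0,1,\dots,r$.
   Context: For a vector space $U$, $\mathcal{F}_U$ is the vector space of all functions $f:G\to U$. $G$ acts on $\mathcal{F}_V$ by $(\tilde\rho_1(g)f)(h)=\rho_1(g)f(g^{-1}h)$ and on $\mathcal{F}_W$ by $(\tilde\rho_2(g)f)(h)=\rho_2(g)f(g^{-1}h)$, for $g,h\in G$. A map $\Psi:\mathcal{F}_V\to\mathcal{F}_W$ is $G$-linear if it is linear and $\Psi(\tilde\rho_1(g)f)=\tilde\rho_2(g)\Psi(f)$ for all $g\in G$ and $f\in\mathcal{F}_V$. A subspace $U$ of a representation $(\rho,V)$ is $G$-invariant if $\rho(g)U\subset U$ for all $g\in G$. The symbol $\subset$ denotes inclusion, not necessarily strict. *)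

theory Defs
  imports Complex_Main "HOL-Algebra.Group_Action"
begin

text \<open>
  Complex vector spaces are whole types equipped with a scalar multiplication \<open>s\<close> satisfying
  the library locale \<^locale>\<open>vector_space\<close>; no dimension restriction is imposed. A representation
  is a homomorphism from \<open>G\<close> to the group of all bijections of the space whose values on
  \<open>carrier G\<close> are linear, i.e. a homomorphism to the general linear group.
\<close>

locale complex_representation =
  group_action G UNIV \<rho> + vector_space s
  for G :: "('g, 'm) monoid_scheme" (structure)
    and s :: "complex \<Rightarrow> 'v::ab_group_add \<Rightarrow> 'v"
    and \<rho> :: "'g \<Rightarrow> 'v \<Rightarrow> 'v" +
  assumes linear_rep: "g \<in> carrier G \<Longrightarrow> Vector_Spaces.linear s s (\<rho> g)"

definition invariant_subspace ::
  "('g, 'm) monoid_scheme \<Rightarrow> (complex \<Rightarrow> 'v::ab_group_add \<Rightarrow> 'v) \<Rightarrow> ('g \<Rightarrow> 'v \<Rightarrow> 'v) \<Rightarrow> 'v set \<Rightarrow> bool"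
  where "invariant_subspace G s \<rho> U \<longleftrightarrow>
    Modules.module.subspace s U \<and> (\<forall>g\<in>carrier G. \<rho> g ` U \<subseteq> U)"

definition invariant_filtration ::
  "('g, 'm) monoid_scheme \<Rightarrow> (complex \<Rightarrow> 'v::ab_group_add \<Rightarrow> 'v) \<Rightarrow> ('g \<Rightarrow> 'v \<Rightarrow> 'v) \<Rightarrow>
    nat \<Rightarrow> (nat \<Rightarrow> 'v set) \<Rightarrow> bool"
  where "invariant_filtration G s \<rho> r V \<longleftrightarrow>
    V 0 = {0} \<and> V r = UNIV \<and>
    (\<forall>i<r. V i \<subseteq> V (Suc i)) \<and>
    (\<forall>i\<le>r. invariant_subspace G s \<rho> (V i))"

text \<open>
  A function on \<open>G\<close> is represented by its unique extensional extension (\<open>undefined\<close> off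
  \<open>carrier G\<close>), so the pointwise operations below are restricted to \<open>carrier G\<close>.
\<close>

definition feature_maps :: "('g, 'm) monoid_scheme \<Rightarrow> 'u set \<Rightarrow> ('g \<Rightarrow> 'u) set"
  where "feature_maps G U = carrier G \<rightarrow>\<^sub>E U"

definition feature_add ::
  "('g, 'm) monoid_scheme \<Rightarrow> ('g \<Rightarrow> 'u::ab_group_add) \<Rightarrow> ('g \<Rightarrow> 'u) \<Rightarrow> 'g \<Rightarrow> 'u"
  where "feature_add G f f' = (\<lambda>h\<in>carrier G. f h + f' h)"

definition feature_scale ::
  "('g, 'm) monoid_scheme \<Rightarrow> (complex \<Rightarrow> 'u \<Rightarrow> 'u) \<Rightarrow> complex \<Rightarrow> ('g \<Rightarrow> 'u) \<Rightarrow> 'g \<Rightarrow> 'u"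
  where "feature_scale G s c f = (\<lambda>h\<in>carrier G. s c (f h))"

definition feature_action ::
  "('g, 'm) monoid_scheme \<Rightarrow> ('g \<Rightarrow> 'u \<Rightarrow> 'u) \<Rightarrow> 'g \<Rightarrow> ('g \<Rightarrow> 'u) \<Rightarrow> 'g \<Rightarrow> 'u"
  where "feature_action G \<rho> g f = (\<lambda>h\<in>carrier G. \<rho> g (f (inv\<^bsub>G\<^esub> g \<otimes>\<^bsub>G\<^esub> h)))"

definition G_linear ::
  "('g, 'm) monoid_scheme \<Rightarrow>
    (complex \<Rightarrow> 'v::ab_group_add \<Rightarrow> 'v) \<Rightarrow> ('g \<Rightarrow> 'v \<Rightarrow> 'v) \<Rightarrow>
    (complex \<Rightarrow> 'w::ab_group_add \<Rightarrow> 'w) \<Rightarrow> ('g \<Rightarrow> 'w \<Rightarrow> 'w) \<Rightarrow>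
    (('g \<Rightarrow> 'v) \<Rightarrow> 'g \<Rightarrow> 'w) \<Rightarrow> bool"
  where "G_linear G s1 \<rho>1 s2 \<rho>2 \<Psi> \<longleftrightarrow>
    \<Psi> \<in> feature_maps G UNIV \<rightarrow> feature_maps G UNIV \<and>
    (\<forall>f\<in>feature_maps G UNIV. \<forall>f'\<in>feature_maps G UNIV.
       \<Psi> (feature_add G f f') = feature_add G (\<Psi> f) (\<Psi> f')) \<and>
    (\<forall>c. \<forall>f\<in>feature_maps G UNIV.
       \<Psi> (feature_scale G s1 c f) = feature_scale G s2 c (\<Psi> f)) \<and>
    (\<forall>g\<in>carrier G. \<forall>f\<in>feature_maps G UNIV.
       \<Psi> (feature_action G \<rho>1 g f) = feature_action G \<rho>2 g (\<Psi> f))"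

end

theory Submission
  imports Defs
begin

text \<open>
  For \<open>i < r\<close> take \<open>W i\<close> to be the span of all values \<open>\<Psi> f h\<close> with \<open>f\<close> a feature map into \<open>V i\<close>,
  and \<open>W r = UNIV\<close>. Equivariance gives \<open>\<rho>2 g (\<Psi> f h) = \<Psi> (g f) (g h)\<close>, and \<open>g f\<close> again takes
  values in \<open>V i\<close>, so the spans are invariant; \<open>W 0 = 0\<close> because \<open>\<Psi>\<close> maps the zero function to
  the zero function.
\<close>

text \<open>For linear \<open>\<Psi>\<close> and a subspace \<open>U\<close>, the values at one
  fixed point form a subspace, but their union over all points need not, so spans are taken
  later.\<close>

definition feature_values ::
  "('g, 'm) monoid_scheme \<Rightarrow> (('g \<Rightarrow> 'v) \<Rightarrow> 'g \<Rightarrow> 'w) \<Rightarrow> 'v set \<Rightarrow> 'w set"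
  where "feature_values G \<Psi> U = (\<Union>f\<in>feature_maps G U. \<Psi> f ` carrier G)"

lemma feature_maps_mono: "U \<subseteq> U' \<Longrightarrow> feature_maps G U \<subseteq> feature_maps G U'"
  unfolding feature_maps_def by (rule PiE_mono)

lemma feature_values_mono: "U \<subseteq> U' \<Longrightarrow> feature_values G \<Psi> U \<subseteq> feature_values G \<Psi> U'"
  unfolding feature_values_def using feature_maps_mono by blast

lemma feature_action_in_feature_maps:
  assumes "group G" "g \<in> carrier G" "\<rho> g ` U \<subseteq> U" "f \<in> feature_maps G U"
  shows "feature_action G \<rho> g f \<in> feature_maps G U"
proof -
  interpret group G by fact
  show ?thesis
    using assms(2-4) by (auto simp: feature_maps_def feature_action_def PiE_iff image_subset_iff)
qed

lemma G_linear_value_action: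
  assumes "group G" "G_linear G s1 \<rho>1 s2 \<rho>2 \<Psi>"
    and "g \<in> carrier G" "h \<in> carrier G" "f \<in> feature_maps G UNIV"
  shows "\<rho>2 g (\<Psi> f h) = \<Psi> (feature_action G \<rho>1 g f) (g \<otimes>\<^bsub>G\<^esub> h)"
proof -
  interpret group G by fact
  have "\<Psi> (feature_action G \<rho>1 g f) = feature_action G \<rho>2 g (\<Psi> f)"
    using assms(2,3,5) unfolding G_linear_def by blast
  then show ?thesis
    \<comment> \<open>Evaluate at \<open>g \<otimes> h\<close>: the action looks up
      \<open>\<Psi> f\<close> at \<open>inv g \<otimes> (g \<otimes> h)\<close>, and regrouping
      cancels this to \<open>h\<close>.\<close>
    using assms(3,4) by (simp add: feature_action_def m_assoc[symmetric])
qed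

text \<open>The evaluation point moves from \<open>h\<close> to \<open>g \<otimes> h\<close>, so it
  matters that the value set ranges over all points of the group.\<close>

lemma feature_values_invariant:
  assumes "group G" "G_linear G s1 \<rho>1 s2 \<rho>2 \<Psi>"
    and "g \<in> carrier G" "\<rho>1 g ` U \<subseteq> U"
  shows "\<rho>2 g ` feature_values G \<Psi> U \<subseteq> feature_values G \<Psi> U"
proof -
  interpret group G by fact
  have "\<rho>2 g (\<Psi> f h) \<in> feature_values G \<Psi> U"
    if "f \<in> feature_maps G U" "h \<in> carrier G" for f h
  proof -
    have "f \<in> feature_maps G UNIV"
      using that(1) feature_maps_mono[OF subset_UNIV] by blast
    then have "\<rho>2 g (\<Psi> f h) = \<Psi> (feature_action G \<rho>1 g f) (g \<otimes>\<^bsub>G\<^esub> h)"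
      using G_linear_value_action[OF assms(1-3) that(2)] by simp
    moreover have "feature_action G \<rho>1 g f \<in> feature_maps G U"
      by (rule feature_action_in_feature_maps[where \<rho> = \<rho>1 and U = U, OF assms(1,3,4) that(1)])
    ultimately show ?thesis
      using m_closed[OF assms(3) that(2)] unfolding feature_values_def by (metis UN_I imageI)
  qed
  then show ?thesis
    unfolding feature_values_def by blast
qed

lemma feature_values_zero:
  assumes "vector_space s1" "vector_space s2" "G_linear G s1 \<rho>1 s2 \<rho>2 \<Psi>"
  shows "feature_values G \<Psi> {0} \<subseteq> {0}"
proof -
  interpret V: vector_space s1 by fact
  interpret W: vector_space s2 by fact
  have "\<Psi> f h = 0" if "f \<in> feature_maps G {0}" "h \<in> carrier G" for f h
  proof -
    \<comment> \<open>This encodes that \<open>f\<close> is the zero map: it vanishes on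
      \<open>carrier G\<close>, and both sides are \<open>undefined\<close> elsewhere. Homogeneity
      then turns \<open>\<Psi> f\<close> into its own multiple by 0.\<close>
    have "feature_scale G s1 0 f = f"
      using that(1) by (auto simp: feature_scale_def feature_maps_def PiE_iff extensional_def fun_eq_iff)
    moreover have "f \<in> feature_maps G UNIV"
      using that(1) feature_maps_mono[OF subset_UNIV] by blast
    ultimately have "\<Psi> f = feature_scale G s2 0 (\<Psi> f)"
      using assms(3) unfolding G_linear_def by metis
    then have "\<Psi> f h = feature_scale G s2 0 (\<Psi> f) h"
      by (rule fun_cong)
    then show ?thesis
      using that(2) by (simp add: feature_scale_def)
  qed
  then show ?thesis
    by (auto simp: feature_values_def)
qed

lemma G_linear_image_feature_maps:
  assumes "G_linear G s1 \<rho>1 s2 \<rho>2 \<Psi>" "feature_values G \<Psi> U \<subseteq> U'"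
  shows "\<Psi> ` feature_maps G U \<subseteq> feature_maps G U'"
proof
  fix y assume "y \<in> \<Psi> ` feature_maps G U"
  then obtain f where f: "f \<in> feature_maps G U" "y = \<Psi> f" by blast
  then have "f \<in> feature_maps G UNIV"
    using feature_maps_mono[OF subset_UNIV] by blast
  \<comment> \<open>This supplies extensionality of \<open>\<Psi> f\<close>; the bound on the values
    only controls it on \<open>carrier G\<close>.\<close>
  then have "\<Psi> f \<in> feature_maps G UNIV"
    using assms(1) unfolding G_linear_def by blast
  moreover have "\<Psi> f h \<in> U'" if "h \<in> carrier G" for h
    using that f(1) assms(2) unfolding feature_values_def by blast
  ultimately show "y \<in> feature_maps G U'"
    using f(2) by (auto simp: feature_maps_def PiE_iff)
qed

text \<open>Linear maps commute with spans, so stability of a generating set passes to the subspace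
  it generates.\<close>

lemma (in complex_representation) invariant_subspace_span:
  assumes "\<And>g. g \<in> carrier G \<Longrightarrow> \<rho> g ` S \<subseteq> S"
  shows "invariant_subspace G s \<rho> (span S)"
  unfolding invariant_subspace_def
proof (intro conjI ballI)
  fix g assume g: "g \<in> carrier G"
  interpret L: Vector_Spaces.linear s s "\<rho> g"
    using g by (rule linear_rep)
  have "\<rho> g ` span S = span (\<rho> g ` S)"
    by (rule L.span_image[symmetric])
  also have "\<dots> \<subseteq> span S"
    using assms[OF g] by (rule span_mono)
  finally show "\<rho> g ` span S \<subseteq> span S" .
qed simp

theorem theorem3p4:
  fixes G :: "('g, 'm) monoid_scheme"
    and sV :: "complex \<Rightarrow> 'v::ab_group_add \<Rightarrow> 'v" and \<rho>1 :: "'g \<Rightarrow> 'v \<Rightarrow> 'v"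
    and sW :: "complex \<Rightarrow> 'w::ab_group_add \<Rightarrow> 'w" and \<rho>2 :: "'g \<Rightarrow> 'w \<Rightarrow> 'w"
    and r :: nat and V :: "nat \<Rightarrow> 'v set"
    and \<Psi> :: "('g \<Rightarrow> 'v) \<Rightarrow> 'g \<Rightarrow> 'w"
  assumes "group G"
    and "complex_representation G sV \<rho>1"
    and "complex_representation G sW \<rho>2"
    and "r \<ge> 1"
    and "invariant_filtration G sV \<rho>1 r V"
    and "G_linear G sV \<rho>1 sW \<rho>2 \<Psi>"
  shows "\<exists>W :: nat \<Rightarrow> 'w set. invariant_filtration G sW \<rho>2 r W \<and>
           (\<forall>i\<le>r. \<Psi> ` feature_maps G (V i) \<subseteq> feature_maps G (W i))"
proof -
  interpret V: complex_representation G sV \<rho>1 by fact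
  interpret W: complex_representation G sW \<rho>2 by fact
  \<comment> \<open>\<open>\<Psi>\<close> may fail to be surjective, so the span at index
    \<open>r\<close> could be proper; the top space is set to \<open>UNIV\<close> by hand.\<close>
  define W where "W i = (if i < r then W.span (feature_values G \<Psi> (V i)) else UNIV)" for i
  have filtration: "V 0 = {0}" "\<And>i. i < r \<Longrightarrow> V i \<subseteq> V (Suc i)"
    "\<And>i g. i \<le> r \<Longrightarrow> g \<in> carrier G \<Longrightarrow> \<rho>1 g ` V i \<subseteq> V i"
    using assms(5) unfolding invariant_filtration_def invariant_subspace_def by auto
  \<comment> \<open>Since \<open>r \<ge> 1\<close>, index 0 falls in the span branch.\<close>
  have "W 0 = {0}"
    using assms(4) feature_values_zero[OF V.vector_space_axioms W.vector_space_axioms assms(6)]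
      W.span_mono[of "feature_values G \<Psi> {0}" "{0}"] W.span_zero
    by (auto simp: W_def filtration(1))
  moreover have "W r = UNIV"
    by (simp add: W_def)
  \<comment> \<open>For \<open>Suc i = r\<close> the right side is \<open>UNIV\<close>; below that,
    spans are monotone.\<close>
  moreover have "W i \<subseteq> W (Suc i)" if "i < r" for i
    using W.span_mono[OF feature_values_mono[OF filtration(2)[OF that]]] by (auto simp: W_def)
  moreover have "invariant_subspace G sW \<rho>2 (W i)" if "i \<le> r" for i
  proof (cases "i < r")
    case True
    have "invariant_subspace G sW \<rho>2 (W.span (feature_values G \<Psi> (V i)))"
    proof (rule W.invariant_subspace_span)
      fix g assume g: "g \<in> carrier G"
      show "\<rho>2 g ` feature_values G \<Psi> (V i) \<subseteq> feature_values G \<Psi> (V i)"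
        using filtration(3)[OF that g] by (rule feature_values_invariant[OF assms(1,6) g])
    qed
    then show ?thesis
      using True by (simp add: W_def)
  next
    case False
    then show ?thesis
      by (simp add: W_def invariant_subspace_def)
  qed
  \<comment> \<open>Each \<open>W i\<close> contains the values from \<open>V i\<close>: as
    generators for \<open>i < r\<close>, trivially from \<open>r\<close> on.\<close>
  moreover have "\<Psi> ` feature_maps G (V i) \<subseteq> feature_maps G (W i)" for i
    using W.span_superset by (intro G_linear_image_feature_maps[OF assms(6)]) (auto simp: W_def)
  ultimately show ?thesis
    unfolding invariant_filtration_def by (intro exI[of _ W]) simp
qed

end
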